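(* Let $B^H=(B^H_t)_{t\in\mathbb R}$ be a two-sided fractional Brownian motion with Hurst index $H\in(0,1)$, and let $\operatorname{gr}(B^H)=\{(t,B^H_t):t\in\mathbb R\}\subseteq\mathbb R^2$ be its graph, equipped with the metric $d_\infty((t,y),(t',y'))=\max\{|t-t'|,|y-y'|\}$. Let $W$ be a Wiener process independent of $B^H$, and let $\varphi:\mathbb R\to\operatorname{gr}(B^H)$ be the map $t\mapsto(t,B^H_t)$. Then, with probability 1 (with respect to $B^H$), the walk dimension $\dim_{\mathcal W}(\operatorname{gr}(B^H),\varphi(W))$ exists and is equal to $\frac2H$.
   Context: A two-sided fractional Brownian motion with Hurst index $H\in(0,1)$ is a centered Gaussian process with $B^H_0=0$ and covariance $\mathbf E[B^H_sB^H_t]=\frac12(|t|^{2H}+|s|^{2H}-|t-s|^{2H})$ for $s,t\in\mathbb R$; a version with continuous paths is used which is almost surely everywhere locally $H$-Hölder regular (i.e. at every point $H$ is the supremum of the exponents $\beta$ such that the path is locally $\beta$-Hölder continuous at that point). The graph is endowed with the pushforward $\varphi_*\lambda^1$ of Lebesgue measure $\lambda^1$ on $\mathbb R$. For a realisation of $B^H$, the process $\varphi(W)$ started at $x=(T,B^H_T)$ is $\varphi(W^T_s)$, $s\ge0$, where $W^T$ is a Wiener process (standard one-dimensional Brownian motion) started at $T$; expectations $\mathbf E_x$ are taken over $W$ only, with $B^H$ fixed. Walk dimension: for a process $M$ on a metric measure space $(X,d,\mu)$ and $x\in X$, let $\tau(r)$ be the first exit time of $M$ from the open ball $B(x,r)$,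 and $\dim_{\mathcal W}(X,M;x):=\lim_{r\searrow0}\frac{\log\mathbf E_x[\tau(r)]}{\log r}$. If this local walk dimension is $\mu$-a.e. constant on $X$, its value is denoted $\dim_{\mathcal W}(X,M)$. *)

theory Defs
  imports "HOL-Probability.Probability"
begin

text \<open>Constants count as degenerate normal random variables, so that \<open>B 0 = 0\<close> is admissible.\<close>

definition gaussian_rv :: "'w measure \<Rightarrow> ('w \<Rightarrow> real) \<Rightarrow> bool" where
  "gaussian_rv M X \<longleftrightarrow> X \<in> borel_measurable M \<and>
     ((\<exists>m. AE \<omega> in M. X \<omega> = m) \<or>
      (\<exists>m \<sigma>. 0 < \<sigma> \<and> distributed M lborel X (normal_density m \<sigma>)))"

definition gaussian_process :: "'w measure \<Rightarrow> ('i \<Rightarrow> 'w \<Rightarrow> real) \<Rightarrow> bool" where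
  "gaussian_process M X \<longleftrightarrow> prob_space M \<and>
     (\<forall>J c. finite J \<longrightarrow> gaussian_rv M (\<lambda>\<omega>. \<Sum>i\<in>J. c i * X i \<omega>))"

definition fractional_brownian_motion ::
    "'w measure \<Rightarrow> real \<Rightarrow> (real \<Rightarrow> 'w \<Rightarrow> real) \<Rightarrow> bool" where
  "fractional_brownian_motion M H B \<longleftrightarrow>
     gaussian_process M B \<and>
     (AE \<omega> in M. B 0 \<omega> = 0) \<and>
     (\<forall>t. (LINT \<omega>|M. B t \<omega>) = 0) \<and>
     (\<forall>s t. (LINT \<omega>|M. B s \<omega> * B t \<omega>) =
        (\<bar>t\<bar> powr (2 * H) + \<bar>s\<bar> powr (2 * H) - \<bar>t - s\<bar> powr (2 * H)) / 2)"

definition locally_holder_at :: "(real \<Rightarrow> real) \<Rightarrow> real \<Rightarrow> real \<Rightarrow> bool" where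
  "locally_holder_at f \<beta> t \<longleftrightarrow>
     (\<exists>C. \<exists>\<delta>>0. \<forall>s\<in>ball t \<delta>. \<forall>s'\<in>ball t \<delta>. \<bar>f s - f s'\<bar> \<le> C * \<bar>s - s'\<bar> powr \<beta>)"

text \<open>The supremum is taken in \<^typ>\<open>ereal\<close>, so that it is meaningful also when the set of
  exponents is empty or unbounded.\<close>

definition holder_regular_at :: "(real \<Rightarrow> real) \<Rightarrow> real \<Rightarrow> real \<Rightarrow> bool" where
  "holder_regular_at f H t \<longleftrightarrow>
     (SUP \<beta>\<in>{\<beta>. 0 < \<beta> \<and> locally_holder_at f \<beta> t}. ereal \<beta>) = ereal H"

text \<open>Only the values \<open>W s\<close> for \<open>s \<ge> 0\<close> are relevant.\<close>

definition wiener_process :: "'v measure \<Rightarrow> real \<Rightarrow> (real \<Rightarrow> 'v \<Rightarrow> real) \<Rightarrow> bool" where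
  "wiener_process N x W \<longleftrightarrow> prob_space N \<and>
     (\<forall>s\<ge>0. W s \<in> borel_measurable N) \<and>
     (AE \<omega> in N. W 0 \<omega> = x) \<and>
     (\<forall>\<omega>\<in>space N. continuous_on {0..} (\<lambda>s. W s \<omega>)) \<and>
     (\<forall>s t. 0 \<le> s \<and> s < t \<longrightarrow>
        distributed N lborel (\<lambda>\<omega>. W t \<omega> - W s \<omega>) (normal_density 0 (sqrt (t - s)))) \<and>
     (\<forall>(n::nat) t. 0 \<le> t 0 \<and> strict_mono_on {..n} t \<longrightarrow>
        prob_space.indep_vars N (\<lambda>_. borel) (\<lambda>i \<omega>. W (t (Suc i)) \<omega> - W (t i) \<omega>) {..<n})"

text \<open>The value is \<open>\<infinity>\<close> if the path never leaves \<open>U\<close>.\<close>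

definition first_exit_time :: "(real \<Rightarrow> 'a) \<Rightarrow> 'a set \<Rightarrow> ennreal" where
  "first_exit_time p U = (INF s\<in>{s. 0 \<le> s \<and> p s \<notin> U}. ennreal s)"

text \<open>A process on \<open>X\<close> is given by a family \<open>Z\<close> on a probability space \<open>N\<close>: for each \<open>x\<close>,
  \<open>\<lambda>s \<omega>. Z x s \<omega>\<close> is the process started at \<open>x\<close>, and its expectation is that of \<open>N\<close>.\<close>

definition mean_exit_time ::
    "'a set \<Rightarrow> ('a \<Rightarrow> 'a \<Rightarrow> real) \<Rightarrow> 'v measure \<Rightarrow> ('a \<Rightarrow> real \<Rightarrow> 'v \<Rightarrow> 'a) \<Rightarrow> 'a \<Rightarrow> real \<Rightarrow> ennreal" where
  "mean_exit_time X d N Z x r =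
     (\<integral>\<^sup>+ \<omega>. first_exit_time (\<lambda>s. Z x s \<omega>) (Metric_space.mball X d x r) \<partial>N)"

text \<open>The first conjunct makes the logarithm a real number: without it the conventions
  \<open>enn2real \<infinity> = 0\<close> and \<open>ln 0 = 0\<close> would interfere.\<close>

definition has_local_walk_dimension ::
    "'a set \<Rightarrow> ('a \<Rightarrow> 'a \<Rightarrow> real) \<Rightarrow> 'v measure \<Rightarrow> ('a \<Rightarrow> real \<Rightarrow> 'v \<Rightarrow> 'a) \<Rightarrow> 'a \<Rightarrow> real \<Rightarrow> bool" where
  "has_local_walk_dimension X d N Z x D \<longleftrightarrow>
     (\<forall>\<^sub>F r in at_right 0. 0 < mean_exit_time X d N Z x r \<and> mean_exit_time X d N Z x r < \<infinity>) \<and>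
     ((\<lambda>r. ln (enn2real (mean_exit_time X d N Z x r)) / ln r) \<longlongrightarrow> D) (at_right 0)"

definition has_walk_dimension ::
    "'a set \<Rightarrow> ('a \<Rightarrow> 'a \<Rightarrow> real) \<Rightarrow> 'a measure \<Rightarrow> 'v measure \<Rightarrow> ('a \<Rightarrow> real \<Rightarrow> 'v \<Rightarrow> 'a) \<Rightarrow> real \<Rightarrow> bool" where
  "has_walk_dimension X d \<mu> N Z D \<longleftrightarrow> (AE x in \<mu>. has_local_walk_dimension X d N Z x D)"

definition d_inf :: "real \<times> real \<Rightarrow> real \<times> real \<Rightarrow> real" where
  "d_inf p q = max \<bar>fst p - fst q\<bar> \<bar>snd p - snd q\<bar>"

lemma Metric_space_d_inf: "Metric_space X d_inf"
  by standard (auto simp: d_inf_def max_def prod_eq_iff)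

definition graph_map :: "(real \<Rightarrow> real) \<Rightarrow> real \<Rightarrow> real \<times> real" where
  "graph_map f t = (t, f t)"

definition graph_of :: "(real \<Rightarrow> real) \<Rightarrow> (real \<times> real) set" where
  "graph_of f = range (graph_map f)"

text \<open>The metric \<^const>\<open>d_inf\<close> induces the standard topology of the plane, so the Borel
  sets of the graph are those inherited from \<^typ>\<open>real \<times> real\<close>.\<close>

definition graph_measure :: "(real \<Rightarrow> real) \<Rightarrow> (real \<times> real) measure" where
  "graph_measure f = distr lborel (restrict_space borel (graph_of f)) (graph_map f)"

text \<open>\<open>W T\<close> is the process on the line started at \<open>T\<close>. Its image under the graph map, started
  at \<open>(T, f T)\<close>, is driven by \<open>W T\<close>. The function \<open>f\<close> is a frozen path of a process on another
  probability space; taking the driving process on a space of its own amounts to independence of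
  the two, realised on the product space.\<close>

definition graph_process ::
    "(real \<Rightarrow> real) \<Rightarrow> (real \<Rightarrow> real \<Rightarrow> 'v \<Rightarrow> real) \<Rightarrow> real \<times> real \<Rightarrow> real \<Rightarrow> 'v \<Rightarrow> real \<times> real" where
  "graph_process f W x s \<omega> = graph_map f (W (fst x) s \<omega>)"

end

theory Submission imports Defs
begin

text \<open>The process leaves the graph ball of radius \<open>r\<close> around \<open>(T, f T)\<close> when \<open>W\<close> leaves
  \<open>{t. \<bar>t - T\<bar> < r \<and> \<bar>f t - f T\<bar> < r}\<close>. The mean exit time of a Wiener process from the interval
  of radius \<open>c\<close> around its starting point is comparable to \<open>c\<^sup>2\<close>, so it suffices to
  sandwich this set between radii \<open>r powr (1 / H + o(1))\<close>, the outer one only through two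
  points at distance \<open>c\<close> on either side of \<open>T\<close> that lie outside the set. The inner radius
  comes from Hoelder continuity of order \<open>\<beta> < H\<close>. For the outer one, Hoelder regularity says
  nothing about a given point \<open>T\<close> and side; instead, for \<open>\<gamma> < 1 / H\<close> and \<open>r = 2 powr -n\<close>, the
  increment of the fractional Brownian motion over \<open>\<plusminus> r powr \<gamma>\<close> is centered Gaussian of
  deviation \<open>r powr (\<gamma> * H)\<close>, hence smaller than \<open>r\<close> with probability at most
  \<open>r powr (1 - \<gamma> * H)\<close>, which is summable in \<open>n\<close>. Borel-Cantelli and Fubini give the bound at
  almost every \<open>T\<close>.\<close>

section \<open>Small-ball and tail estimates for normal variables\<close>

text \<open>The density is at most \<open>1 / (2 * \<sigma>)\<close>, because
  \<open>4 \<le> 2 * pi\<close>, and the interval has length \<open>2 * x\<close>.\<close>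

lemma (in prob_space) normal_prob_small:
  assumes \<sigma>: "0 < \<sigma>" and D: "distributed M lborel X (normal_density 0 \<sigma>)" and x: "0 \<le> x"
  shows "prob {\<omega> \<in> space M. \<bar>X \<omega>\<bar> < x} \<le> x / \<sigma>"
proof -
  have "4 \<le> 2 * pi" using pi_ge_two by simp
  then have "(2 * \<sigma>)\<^sup>2 \<le> 2 * pi * \<sigma>\<^sup>2"
    by (simp add: power_mult_distrib mult_right_mono)
  then have s: "2 * \<sigma> \<le> sqrt (2 * pi * \<sigma>\<^sup>2)"
    by (rule real_le_rsqrt)
  have dens: "normal_density 0 \<sigma> y \<le> 1 / (2 * \<sigma>)" for y
  proof -
    have "normal_density 0 \<sigma> y \<le> 1 / sqrt (2 * pi * \<sigma>\<^sup>2) * 1"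
      unfolding normal_density_def by (intro mult_left_mono) auto
    also have "\<dots> \<le> 1 / (2 * \<sigma>)"
      using s \<sigma> by (simp add: frac_le)
    finally show ?thesis .
  qed
  have eq: "{\<omega> \<in> space M. \<bar>X \<omega>\<bar> < x} = X -` {-x<..<x} \<inter> space M"
    by auto
  have "emeasure M {\<omega> \<in> space M. \<bar>X \<omega>\<bar> < x} =
      (\<integral>\<^sup>+y. ennreal (normal_density 0 \<sigma> y) * indicator {-x<..<x} y \<partial>lborel)"
    unfolding eq by (rule distributed_emeasure[OF D]) simp
  also have "\<dots> \<le> (\<integral>\<^sup>+y. ennreal (1 / (2 * \<sigma>)) * indicator {-x<..<x} y \<partial>lborel)"
    by (intro nn_integral_mono mult_right_mono ennreal_leI dens) simp
  also have "\<dots> = ennreal (1 / (2 * \<sigma>)) * ennreal (2 * x)"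
    using x by (subst nn_integral_cmult) auto
  also have "\<dots> = ennreal (x / \<sigma>)"
    using \<sigma> x by (simp flip: ennreal_mult)
  finally show ?thesis
    using \<sigma> x by (simp add: emeasure_eq_measure)
qed

text \<open>Markov's inequality for the fourth power. Second moments would not do for the chaining
  below: \<open>2 ^ m\<close> increments of variance \<open>h / 2 ^ m\<close> leave no decay in
  \<open>m\<close> to pay for shrinking thresholds.\<close>

lemma (in prob_space) normal_prob_large:
  assumes \<sigma>: "0 < \<sigma>" and D: "distributed M lborel X (normal_density 0 \<sigma>)" and x: "0 < x"
  shows "prob {\<omega> \<in> space M. x \<le> \<bar>X \<omega>\<bar>} \<le> 3 * \<sigma> ^ 4 / x ^ 4"
proof -
  have [measurable]: "X \<in> borel_measurable M"
    using distributed_measurable[OF D] by simp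
  have int: "integrable M (\<lambda>\<omega>. X \<omega> ^ 4)"
    using integrable_normal_moment[OF \<sigma>, of 0 4] distributed_integrable[OF D, of "\<lambda>y. y ^ 4"]
    by simp
  have "fact 4 / ((2 / \<sigma>\<^sup>2)\<^sup>2 * fact 2) = 3 * \<sigma> ^ 4"
    using \<sigma> by (simp add: fact_numeral field_simps)
  then have mom: "expectation (\<lambda>\<omega>. X \<omega> ^ 4) = 3 * \<sigma> ^ 4"
    using integral_normal_moment_even[OF \<sigma>, of 0 2] distributed_integral[OF D, of "\<lambda>y. y ^ 4"]
    by simp
  have "{\<omega> \<in> space M. x \<le> \<bar>X \<omega>\<bar>} = {\<omega> \<in> space M. x ^ 4 \<le> X \<omega> ^ 4}"
    using x power_mono_iff[of x "\<bar>X _\<bar>" 4] by (simp add: power_even_abs)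
  then have "prob {\<omega> \<in> space M. x \<le> \<bar>X \<omega>\<bar>} \<le> expectation (\<lambda>\<omega>. X \<omega> ^ 4) / x ^ 4"
    using x by (simp, intro integral_Markov_inequality_measure[OF int, of "{}"]) auto
  then show ?thesis by (simp add: mom)
qed

section \<open>Upper bound for the mean exit time of a Wiener process\<close>

text \<open>By the intermediate value theorem the path meets \<open>x + c\<close> or
  \<open>x - c\<close> by time \<open>s\<close>. Only these two points of the complement of
  \<open>U\<close> enter, since a graph ball pulled back to the line may be disconnected.\<close>

lemma first_exit_time_le_of_boundary:
  assumes cont: "continuous_on {0..} w" and w0: "w 0 = x"
    and U: "x + c \<notin> U" "x - c \<notin> U" and s: "0 \<le> s" "c \<le> \<bar>w s - x\<bar>" and c: "0 < (c::real)"
  shows "first_exit_time w U \<le> ennreal s"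
proof -
  have cont': "continuous_on {0..s} w"
    by (rule continuous_on_subset[OF cont]) auto
  obtain s' where s': "0 \<le> s'" "s' \<le> s" "w s' = x + c \<or> w s' = x - c"
  proof (cases "x + c \<le> w s")
    case True
    then show ?thesis
      using IVT'[of w 0 "x + c" s] w0 s c cont' that by auto
  next
    case False
    then have "w s \<le> x - c" using s by linarith
    then show ?thesis
      using IVT2'[of w s "x - c" 0] w0 s c cont' that by auto
  qed
  then have "first_exit_time w U \<le> ennreal s'"
    unfolding first_exit_time_def using U by (intro INF_lower) auto
  also have "\<dots> \<le> ennreal s" using s' by (intro ennreal_leI)
  finally show ?thesis .
qed

lemma wiener_exit_upper:
  assumes W: "wiener_process N x W" and c: "0 < c" and U: "x + c \<notin> U" "x - c \<notin> U"
  shows "(\<integral>\<^sup>+ \<omega>. first_exit_time (\<lambda>s. W s \<omega>) U \<partial>N) \<le> ennreal (32 * c\<^sup>2)"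
proof -
  interpret prob_space N using W by (simp add: wiener_process_def)
  \<comment> \<open>An increment of size at least \<open>2 * c\<close> forces an exit; over a time step of \<open>16 * c\<^sup>2\<close> it
    has probability at least \<open>1/2\<close>, so the number of steps before exit is dominated by a
    geometric variable.\<close>
  define t where "t i = real i * (16 * c\<^sup>2)" for i :: nat
  define D where "D i \<omega> = W (t (Suc i)) \<omega> - W (t i) \<omega>" for i \<omega>
  define A where "A n = {\<omega> \<in> space N. \<forall>i<n. \<bar>D i \<omega>\<bar> < 2 * c}" for n
  have t0: "0 \<le> t i" for i by (simp add: t_def)
  have meas_W: "W (t i) \<in> borel_measurable N" for i
    using W t0 by (simp add: wiener_process_def)
  have meas_D[measurable]: "D i \<in> borel_measurable N" for i
    unfolding D_def using meas_W by measurable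
  have meas_A[measurable]: "A n \<in> sets N" for n
    unfolding A_def by measurable
  have smono: "strict_mono_on {..n} t" for n
    using c by (auto simp: t_def strict_mono_on_def)
  have indep: "indep_vars (\<lambda>_. borel) D {..<n}" for n
    using W smono t0 unfolding wiener_process_def D_def by blast
  have D_small: "prob {\<omega> \<in> space N. \<bar>D i \<omega>\<bar> < 2 * c} \<le> 1 / 2" for i
  proof -
    have "t (Suc i) - t i = (4 * c)\<^sup>2" by (simp add: t_def algebra_simps power2_eq_square)
    moreover have "t i < t (Suc i)" using c by (simp add: t_def)
    ultimately have "distributed N lborel (D i) (normal_density 0 (4 * c))"
      using W t0[of i] c unfolding wiener_process_def D_def
      by (metis real_sqrt_unique less_imp_le mult_pos_pos zero_less_numeral)
    from normal_prob_small[OF _ this, of "2 * c"] show ?thesis using c by simp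
  qed
  have A_le: "prob (A n) \<le> (1 / 2) ^ n" for n
  proof (cases "n = 0")
    \<comment> \<open>The product rule wants a nonempty index set; over the empty one the
      intersection below would be \<open>UNIV\<close> instead of \<open>space N\<close>.\<close>
    case False
    have "A n = (\<Inter>i\<in>{..<n}. D i -` {-(2 * c)<..<2 * c} \<inter> space N)"
      using False by (auto simp: A_def abs_less_iff)
    also have "prob \<dots> = (\<Prod>i<n. prob (D i -` {-(2 * c)<..<2 * c} \<inter> space N))"
      using False by (intro indep_varsD_finite[OF indep]) auto
    also have "\<dots> = (\<Prod>i<n. prob {\<omega> \<in> space N. \<bar>D i \<omega>\<bar> < 2 * c})"
      by (intro prod.cong arg_cong[where f=prob]) auto
    also have "\<dots> \<le> (\<Prod>i<n. 1 / 2)"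
      using D_small by (intro prod_mono) auto
    finally show ?thesis by (simp add: power_one_over)
  qed simp
  \<comment> \<open>If \<open>A m\<close> is the first event to fail, the sum of indicators is at
    least \<open>m\<close>; if none fails, it is infinite. Integrating it gives the sum of the tail
    probabilities \<open>prob (A n)\<close>.\<close>
  have exit_le: "first_exit_time (\<lambda>s. W s \<omega>) U \<le> ennreal (16 * c\<^sup>2) * (\<Sum>n. indicator (A n) \<omega>)"
    if \<omega>: "\<omega> \<in> space N" "W 0 \<omega> = x" for \<omega>
  proof -
    have partial: "of_nat m \<le> (\<Sum>n. indicator (A n) \<omega> :: ennreal)" if "\<And>n. n < m \<Longrightarrow> \<omega> \<in> A n" for m
    proof -
      have "of_nat m = (\<Sum>n<m. indicator (A n) \<omega> :: ennreal)" using that by simp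
      also have "\<dots> \<le> (\<Sum>n. indicator (A n) \<omega>)" by (intro sum_le_suminf) auto
      finally show ?thesis .
    qed
    show ?thesis
    proof (cases "\<forall>n. \<omega> \<in> A n")
      case True
      have "(\<Sum>n. indicator (A n) \<omega> :: ennreal) = \<top>"
        using partial True ennreal_Ex_less_of_nat by (metis infinity_ennreal_def less_top not_le)
      then show ?thesis using c by (simp add: ennreal_mult_top)
    next
      case False
      define m where "m = (LEAST n. \<omega> \<notin> A n)"
      have m: "\<omega> \<notin> A m" using False unfolding m_def by (metis LeastI)
      have lt: "\<omega> \<in> A n" if "n < m" for n using not_less_Least that unfolding m_def by blast
      obtain i where i: "i < m" "2 * c \<le> \<bar>D i \<omega>\<bar>"
        using m \<omega> by (auto simp: A_def not_less)
      \<comment> \<open>By the triangle inequality an increment of size \<open>2 * c\<close> has an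
        endpoint at distance at least \<open>c\<close> from \<open>x\<close>; as
        \<open>i < m\<close>, both endpoints have index at most \<open>m\<close>.\<close>
      then have "c \<le> \<bar>W (t (Suc i)) \<omega> - x\<bar> \<or> c \<le> \<bar>W (t i) \<omega> - x\<bar>"
        by (auto simp: D_def)
      then obtain j where j: "j \<le> m" "c \<le> \<bar>W (t j) \<omega> - x\<bar>"
        using i by (metis Suc_leI less_imp_le)
      have "first_exit_time (\<lambda>s. W s \<omega>) U \<le> ennreal (t j)"
        using W \<omega> U j c t0 by (intro first_exit_time_le_of_boundary) (auto simp: wiener_process_def)
      also have "\<dots> \<le> ennreal (16 * c\<^sup>2 * real m)"
        using j c by (intro ennreal_leI) (simp add: t_def)
      also have "\<dots> = ennreal (16 * c\<^sup>2) * of_nat m"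
        using c by (simp add: ennreal_mult ennreal_of_nat_eq_real_of_nat)
      also have "\<dots> \<le> ennreal (16 * c\<^sup>2) * (\<Sum>n. indicator (A n) \<omega>)"
        using partial lt by (intro mult_left_mono) auto
      finally show ?thesis .
    qed
  qed
  have "(\<integral>\<^sup>+ \<omega>. first_exit_time (\<lambda>s. W s \<omega>) U \<partial>N)
      \<le> (\<integral>\<^sup>+ \<omega>. ennreal (16 * c\<^sup>2) * (\<Sum>n. indicator (A n) \<omega>) \<partial>N)"
  proof (rule nn_integral_mono_AE)
    have "AE \<omega> in N. W 0 \<omega> = x" using W by (simp add: wiener_process_def)
    then show "AE \<omega> in N. first_exit_time (\<lambda>s. W s \<omega>) U
        \<le> ennreal (16 * c\<^sup>2) * (\<Sum>n. indicator (A n) \<omega>)"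
      using AE_space by eventually_elim (rule exit_le)
  qed
  also have "\<dots> = ennreal (16 * c\<^sup>2) * (\<Sum>n. emeasure N (A n))"
    by (simp add: nn_integral_cmult nn_integral_suminf)
  also have "\<dots> \<le> ennreal (16 * c\<^sup>2) * (\<Sum>n. ennreal ((1 / 2) ^ n))"
    using A_le by (intro mult_left_mono suminf_le) (auto simp: emeasure_eq_measure intro!: ennreal_leI)
  also have "(\<Sum>n. ennreal ((1 / 2) ^ n)) = ennreal 2"
    by (intro suminf_ennreal_eq) (use geometric_sums[of "1/2::real"] in auto)
  also have "ennreal (16 * c\<^sup>2) * ennreal 2 = ennreal (32 * c\<^sup>2)"
    by (subst ennreal_mult[symmetric]) auto
  finally show ?thesis .
qed

section \<open>Lower bound for the mean exit time, by dyadic chaining\<close>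

text \<open>Induction on the level: an even index names a point of the previous level and an odd one
  is a single step away from such a point, so each level contributes at most one increment.\<close>

lemma dyadic_chaining:
  fixes w :: "real \<Rightarrow> real" and a :: "nat \<Rightarrow> real"
  assumes inc: "\<And>m k. k < 2 ^ m \<Longrightarrow> \<bar>w (real (Suc k) * h / 2 ^ m) - w (real k * h / 2 ^ m)\<bar> \<le> a m"
    and a: "\<And>m. 0 \<le> a m" and k: "k \<le> 2 ^ m"
  shows "\<bar>w (real k * h / 2 ^ m) - w 0\<bar> \<le> (\<Sum>j\<le>m. a j)"
  using k
proof (induction m arbitrary: k)
  case 0
  then have "k = 0 \<or> k = 1" by auto
  then show ?case using inc[of 0 0] a[of 0] by auto
next
  case (Suc m)
  have half: "real (2 * l) * h / 2 ^ Suc m = real l * h / 2 ^ m" for l by simp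
  show ?case
  proof (cases "even k")
    case True
    then obtain l where l: "k = 2 * l" by blast
    then have "\<bar>w (real k * h / 2 ^ Suc m) - w 0\<bar> \<le> (\<Sum>j\<le>m. a j)"
      unfolding l half using Suc l by auto
    then show ?thesis using a[of "Suc m"] by simp
  next
    case False
    then obtain l where l: "k = Suc (2 * l)" by (metis oddE Suc_eq_plus1)
    then have "\<bar>w (real (2 * l) * h / 2 ^ Suc m) - w 0\<bar> \<le> (\<Sum>j\<le>m. a j)"
      unfolding half using Suc by auto
    moreover have "\<bar>w (real k * h / 2 ^ Suc m) - w (real (2 * l) * h / 2 ^ Suc m)\<bar> \<le> a (Suc m)"
      using inc[of "2 * l" "Suc m"] l Suc.prems by simp
    ultimately show ?thesis by simp
  qed
qed

text \<open>Rounding \<open>s / h\<close> down at level \<open>m\<close> gives dyadic points that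
  stay in \<open>{0..h}\<close> and converge to \<open>s\<close>; the closed bound passes to the
  limit by continuity.\<close>

lemma dyadic_bound_extends:
  fixes w :: "real \<Rightarrow> real"
  assumes cont: "continuous_on {0..} w" and h: "0 < h"
    and bound: "\<And>m k. k \<le> 2 ^ m \<Longrightarrow> \<bar>w (real k * h / 2 ^ m) - x\<bar> \<le> b" and s: "0 \<le> s" "s \<le> h"
  shows "\<bar>w s - x\<bar> \<le> b"
proof -
  define k where "k m = nat \<lfloor>s / h * 2 ^ m\<rfloor>" for m
  define q where "q m = real (k m) * h / 2 ^ m" for m
  have k_real: "real (k m) = of_int \<lfloor>s / h * 2 ^ m\<rfloor>" for m
    using s h by (simp add: k_def)
  have k_le: "real (k m) \<le> s / h * 2 ^ m" "s / h * 2 ^ m - 1 \<le> real (k m)" for m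
    unfolding k_real by linarith+
  have "s / h * 2 ^ m \<le> 2 ^ m" for m
    using s h by (simp add: field_simps)
  then have "real (k m) \<le> real (2 ^ m)" for m
    using k_le(1)[of m] order_trans by fastforce
  then have k2: "k m \<le> 2 ^ m" for m by (simp only: of_nat_le_iff)
  have q_le: "q m \<le> s" "s - h * (1 / 2) ^ m \<le> q m" for m
    using mult_right_mono[OF k_le(1)[of m], of "h / 2 ^ m"] mult_right_mono[OF k_le(2)[of m], of "h / 2 ^ m"] h
    by (simp_all add: q_def left_diff_distrib diff_divide_distrib power_one_over)
  have "(\<lambda>m. s - h * (1 / 2) ^ m) \<longlonglongrightarrow> s - h * 0"
    by (intro tendsto_intros LIMSEQ_power_zero) simp
  then have "q \<longlonglongrightarrow> s"
    by (intro tendsto_sandwich[of "\<lambda>m. s - h * (1 / 2) ^ m" q sequentially "\<lambda>_. s"])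
      (use q_le in auto)
  moreover have q_ge: "0 \<le> q m" for m using h by (simp add: q_def)
  ultimately have "(\<lambda>m. w (q m)) \<longlonglongrightarrow> w s"
    using h s by (intro continuous_on_tendsto_compose[OF cont, of q]) (auto simp: q_ge)
  then have "(\<lambda>m. \<bar>w (q m) - x\<bar>) \<longlonglongrightarrow> \<bar>w s - x\<bar>"
    by (intro tendsto_intros)
  then show ?thesis
    by (rule LIMSEQ_le_const2) (use bound k2 in \<open>auto simp: q_def\<close>)
qed

text \<open>The path stays in the ball up to time \<open>h\<close> unless some dyadic increment is large. With
  thresholds of ratio \<open>9/10\<close> the union bound over the \<open>2 ^ m\<close> increments of level \<open>m\<close>, by
  fourth moments, has ratio \<open>2 / (2\<^sup>2 * (9/10) ^ 4) < 1\<close>; \<open>h\<close> is chosen to make the total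
  less than \<open>1/2\<close>.\<close>

lemma wiener_exit_lower:
  assumes W: "wiener_process N x W" and c: "0 < c" and U: "ball x c \<subseteq> U"
  shows "ennreal (c\<^sup>2 / 20000) \<le> (\<integral>\<^sup>+ \<omega>. first_exit_time (\<lambda>s. W s \<omega>) U \<partial>N)"
proof -
  interpret prob_space N using W by (simp add: wiener_process_def)
  \<comment> \<open>The thresholds sum to \<open>c / 20 * 10 = c / 2\<close>, which keeps the path
    strictly inside the ball. At level \<open>0\<close> the union bound is
    \<open>3 * h ^ 2 / (c / 20) ^ 4 = 3 / 625\<close>.\<close>
  define h where "h = c\<^sup>2 / 10000"
  define a where "a m = c / 20 * (9 / 10) ^ m" for m :: nat
  define D where "D m k \<omega> = W (real (Suc k) * h / 2 ^ m) \<omega> - W (real k * h / 2 ^ m) \<omega>" for m k :: nat and \<omega>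
  define E where "E m k = {\<omega> \<in> space N. a m \<le> \<bar>D m k \<omega>\<bar>}" for m k
  define F where "F m = (\<Union>k<2 ^ m. E m k)" for m
  have h: "0 < h" using c by (simp add: h_def)
  have a: "0 < a m" for m using c by (simp add: a_def)
  have meas_W: "W (real k * h / 2 ^ m) \<in> borel_measurable N" for k m
    using W h by (simp add: wiener_process_def)
  have meas_D[measurable]: "D m k \<in> borel_measurable N" for m k
    unfolding D_def using meas_W by measurable
  have meas_E[measurable]: "E m k \<in> sets N" for m k unfolding E_def by measurable
  have meas_F[measurable]: "F m \<in> sets N" for m unfolding F_def by measurable
  have prob_E: "prob (E m k) \<le> 3 * (h / 2 ^ m)\<^sup>2 / a m ^ 4" for m k
  proof -
    have "real (Suc k) * h / 2 ^ m - real k * h / 2 ^ m = h / 2 ^ m"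
      by (simp add: field_simps)
    moreover have "0 \<le> real k * h / 2 ^ m" "real k * h / 2 ^ m < real (Suc k) * h / 2 ^ m"
      using h by (auto intro!: divide_strict_right_mono mult_strict_right_mono)
    ultimately have "distributed N lborel (D m k) (normal_density 0 (sqrt (h / 2 ^ m)))"
      using W unfolding wiener_process_def D_def by metis
    from normal_prob_large[OF _ this a[of m]]
    have "prob (E m k) \<le> 3 * sqrt (h / 2 ^ m) ^ 4 / a m ^ 4"
      using h by (simp add: E_def)
    also have "sqrt (h / 2 ^ m) ^ 4 = (sqrt (h / 2 ^ m) ^ 2)\<^sup>2"
      by (simp flip: power_mult)
    also have "sqrt (h / 2 ^ m) ^ 2 = h / 2 ^ m" using h by (intro real_sqrt_pow2) simp
    finally show ?thesis .
  qed
  have prob_F: "prob (F m) \<le> 3 / 625 * (4 / 5) ^ m" for m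
  proof -
    have "prob (F m) \<le> (\<Sum>k<2 ^ m. prob (E m k))"
      unfolding F_def by (intro finite_measure_subadditive_finite) auto
    also have "\<dots> \<le> (\<Sum>k<(2::nat) ^ m. 3 * (h / 2 ^ m)\<^sup>2 / a m ^ 4)"
      by (intro sum_mono prob_E)
    also have "\<dots> = 2 ^ m * (3 * (h / 2 ^ m)\<^sup>2 / a m ^ 4)" by simp
    also have "\<dots> = 3 / 625 * (2 ^ m * (1 / (2 ^ m)\<^sup>2) * (1 / ((9 / 10) ^ m) ^ 4))"
      using c by (simp add: h_def a_def power_divide power_mult_distrib field_simps)
    \<comment> \<open>The ratio \<open>2 / (2 ^ 2 * (9 / 10) ^ 4)\<close> in lowest terms, rounded
      up to \<open>4 / 5\<close> afterwards; the total is then \<open>3 / 125\<close>.\<close>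
    also have "\<dots> = 3 / 625 * (5000 / 6561) ^ m"
    proof -
      have "(5000 / 6561 :: real) = 2 * (1 / 2 ^ 2) * (1 / (9 / 10) ^ 4)"
        by (simp add: power_divide)
      then have "(5000 / 6561 :: real) ^ m = 2 ^ m * (1 / (2 ^ m)\<^sup>2) * (1 / ((9 / 10) ^ m) ^ 4)"
        by (simp only: power_mult_distrib power_one_over power_commutes flip: power_mult)
          (simp add: mult.commute)
      then show ?thesis by simp
    qed
    also have "\<dots> \<le> 3 / 625 * (4 / 5) ^ m"
      by (intro mult_left_mono power_mono) auto
    finally show ?thesis .
  qed
  have summ: "(\<lambda>m. 3 / 625 * (4 / 5) ^ m :: real) sums (3 / 125)"
    using sums_mult[OF geometric_sums[of "4/5::real"], of "3 / 625"] by simp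
  have sumF: "summable (\<lambda>m. prob (F m))"
    by (rule summable_comparison_test'[OF sums_summable[OF summ]]) (use prob_F in auto)
  have "prob (\<Union>m. F m) \<le> (\<Sum>m. prob (F m))"
    by (intro finite_measure_subadditive_countably sumF) auto
  also have "\<dots> \<le> 3 / 125"
    using suminf_le[OF prob_F sumF sums_summable[OF summ]] sums_unique[OF summ] by simp
  finally have G: "1 / 2 \<le> prob (space N - (\<Union>m. F m))"
    by (subst prob_compl) auto
  have exit_ge: "ennreal h * indicator (space N - (\<Union>m. F m)) \<omega> \<le> first_exit_time (\<lambda>s. W s \<omega>) U"
    if \<omega>: "\<omega> \<in> space N" "W 0 \<omega> = x" for \<omega>
  proof (cases "\<omega> \<in> (\<Union>m. F m)")
    case False
    have geo: "(\<Sum>j\<le>m. a j) \<le> c / 2" for m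
    proof -
      have "(\<Sum>j\<le>m. a j) = c / 20 * (\<Sum>j\<le>m. (9 / 10) ^ j)" by (simp add: a_def sum_distrib_left)
      also have "\<dots> \<le> c / 20 * 10"
        using c sum_le_suminf[of "\<lambda>j. (9 / 10 :: real) ^ j" "{..m}"] suminf_geometric[of "9 / 10 :: real"]
        by (intro mult_left_mono) auto
      finally show ?thesis by simp
    qed
    have inc: "\<bar>W (real (Suc k) * h / 2 ^ m) \<omega> - W (real k * h / 2 ^ m) \<omega>\<bar> \<le> a m" if "k < 2 ^ m" for m k
      using False that \<omega> by (force simp: F_def E_def D_def)
    have dy: "\<bar>W (real k * h / 2 ^ m) \<omega> - x\<bar> \<le> c / 2" if "k \<le> 2 ^ m" for m k
      using dyadic_chaining[of "\<lambda>s. W s \<omega>" h a, OF inc less_imp_le[OF a] that] geo[of m] \<omega> by simp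
    have "continuous_on {0..} (\<lambda>s. W s \<omega>)"
      using W \<omega> by (simp add: wiener_process_def)
    then have "\<bar>W s \<omega> - x\<bar> \<le> c / 2" if "0 \<le> s" "s \<le> h" for s
      using dyadic_bound_extends[of "\<lambda>s. W s \<omega>" h x "c / 2", OF _ h dy that] by simp
    then have "W s \<omega> \<in> U" if "0 \<le> s" "s \<le> h" for s
      using U c that by (intro subsetD[OF U]) (fastforce simp: dist_real_def abs_minus_commute)
    \<comment> \<open>Every time in the infimum exceeds \<open>h\<close>; if there is none, the
      infimum is infinite.\<close>
    then have "ennreal h \<le> first_exit_time (\<lambda>s. W s \<omega>) U"
      unfolding first_exit_time_def by (intro INF_greatest ennreal_leI) (force simp: not_le)
    then show ?thesis by (auto split: split_indicator)
  qed simp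
  have "ennreal (c\<^sup>2 / 20000) = ennreal h * ennreal (1 / 2)"
    by (subst ennreal_mult[symmetric]) (auto simp: h_def)
  also have "\<dots> \<le> ennreal h * emeasure N (space N - (\<Union>m. F m))"
    unfolding emeasure_eq_measure using G by (intro mult_left_mono ennreal_leI) auto
  also have "\<dots> = (\<integral>\<^sup>+ \<omega>. ennreal h * indicator (space N - (\<Union>m. F m)) \<omega> \<partial>N)"
    by (subst nn_integral_cmult_indicator) auto
  also have "\<dots> \<le> (\<integral>\<^sup>+ \<omega>. first_exit_time (\<lambda>s. W s \<omega>) U \<partial>N)"
  proof (rule nn_integral_mono_AE)
    have "AE \<omega> in N. W 0 \<omega> = x" using W by (simp add: wiener_process_def)
    then show "AE \<omega> in N. ennreal h * indicator (space N - (\<Union>m. F m)) \<omega>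
        \<le> first_exit_time (\<lambda>s. W s \<omega>) U"
      using AE_space by eventually_elim (rule exit_ge)
  qed
  finally show ?thesis .
qed

section \<open>From power bounds to a logarithmic limit\<close>

lemma ln_cmult_powr:
  assumes "0 < k" "0 < r"
  shows "ln (k * r powr p) = ln k + p * ln (r::real)"
  using assms by (simp add: ln_mult)

text \<open>Constants may depend on \<open>\<epsilon>\<close>, as \<open>ln k / ln r\<close>
  vanishes in the limit. Since \<open>ln r < 0\<close> for small \<open>r\<close>, division reverses
  the order: the lower bound on \<open>E r\<close> bounds the quotient from above, and
  conversely.\<close>

lemma log_limit_from_power_bounds:
  fixes E :: "real \<Rightarrow> ennreal" and D :: real
  assumes lower: "\<And>\<epsilon>. 0 < \<epsilon> \<Longrightarrow> \<exists>k>0. \<forall>\<^sub>F r in at_right 0. ennreal (k * r powr (D + \<epsilon>)) \<le> E r"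
    and upper: "\<And>\<epsilon>. 0 < \<epsilon> \<Longrightarrow> \<exists>k>0. \<forall>\<^sub>F r in at_right 0. E r \<le> ennreal (k * r powr (D - \<epsilon>))"
  shows "(\<forall>\<^sub>F r in at_right 0. 0 < E r \<and> E r < \<infinity>) \<and>
    ((\<lambda>r. ln (enn2real (E r)) / ln r) \<longlongrightarrow> D) (at_right 0)"
proof
  have pos: "\<forall>\<^sub>F r in at_right 0. (0::real) < r" "\<forall>\<^sub>F r in at_right 0. r < (1::real)"
    by (auto intro: eventually_at_right_less eventually_at_rightI[of 0 1])
  obtain k1 k2 :: real where k: "0 < k1" "0 < k2"
    and ev: "\<forall>\<^sub>F r in at_right 0. ennreal (k1 * r powr (D + 1)) \<le> E r"
      "\<forall>\<^sub>F r in at_right 0. E r \<le> ennreal (k2 * r powr (D - 1))"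
    using lower[of 1] upper[of 1] by auto
  show "\<forall>\<^sub>F r in at_right 0. 0 < E r \<and> E r < \<infinity>"
    using ev pos(1)
  proof eventually_elim
    case (elim r)
    have "0 < ennreal (k1 * r powr (D + 1))" using k elim by simp
    then have "0 < E r" using elim(1) by (rule less_le_trans)
    with elim(2) show ?case by (auto intro: le_less_trans)
  qed
  show "((\<lambda>r. ln (enn2real (E r)) / ln r) \<longlongrightarrow> D) (at_right 0)"
  proof (rule tendstoI)
    fix e :: real assume e: "0 < e"
    \<comment> \<open>Half of \<open>e\<close> is spent on the exponent, the other half on
      \<open>ln k / ln r\<close>.\<close>
    obtain k1 k2 :: real where k: "0 < k1" "0 < k2"
      and ev: "\<forall>\<^sub>F r in at_right 0. ennreal (k1 * r powr (D + e / 2)) \<le> E r"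
        "\<forall>\<^sub>F r in at_right 0. E r \<le> ennreal (k2 * r powr (D - e / 2))"
      using lower[of "e / 2"] upper[of "e / 2"] e by auto
    have vanish: "((\<lambda>r. ln k / ln r) \<longlongrightarrow> 0) (at_right 0)" for k :: real
      using ln_at_0 tendsto_divide_0[OF tendsto_const] filterlim_at_bot_imp_at_infinity by blast
    have small: "\<forall>\<^sub>F r in at_right 0. \<bar>ln k / ln r\<bar> < e / 2" for k :: real
      using tendstoD[OF vanish[of k], of "e / 2"] e by (simp add: dist_real_def)
    show "\<forall>\<^sub>F r in at_right 0. dist (ln (enn2real (E r)) / ln r) D < e"
      using ev pos small[of k1] small[of k2]
    proof eventually_elim
      case (elim r)
      define y where "y = enn2real (E r)"
      have Ey: "E r = ennreal y"
        using elim(2) unfolding y_def by (metis ennreal_enn2real ennreal_less_top le_less_trans)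
      have y0: "0 \<le> y" by (simp add: y_def)
      have b: "k1 * r powr (D + e / 2) \<le> y" "y \<le> k2 * r powr (D - e / 2)"
        using elim k y0 unfolding Ey by (simp_all add: ennreal_le_iff)
      have p: "0 < k1 * r powr (D + e / 2)" using k elim by simp
      have "ln (k1 * r powr (D + e / 2)) \<le> ln y" "ln y \<le> ln (k2 * r powr (D - e / 2))"
        using b p by (auto intro!: ln_mono)
      then have l: "ln k1 + (D + e / 2) * ln r \<le> ln y" "ln y \<le> ln k2 + (D - e / 2) * ln r"
        using k elim ln_cmult_powr by auto
      have n: "ln r < 0" using elim by simp
      have "ln y / ln r \<le> (ln k1 + (D + e / 2) * ln r) / ln r"
        "(ln k2 + (D - e / 2) * ln r) / ln r \<le> ln y / ln r"
        using l n by (auto intro: divide_right_mono_neg)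
      then have "ln y / ln r \<le> ln k1 / ln r + (D + e / 2)"
        "ln k2 / ln r + (D - e / 2) \<le> ln y / ln r"
        using n by (simp_all add: add_divide_distrib)
      then show ?case using elim unfolding y_def[symmetric] dist_real_def by linarith
    qed
  qed
qed

section \<open>Graph balls and the local walk dimension for a fixed path\<close>

text \<open>Pulls the ball back along \<open>graph_map f\<close>, so that the later estimates
  concern the process on the line.\<close>

lemma mean_exit_time_graph:
  "mean_exit_time (graph_of f) d_inf N (graph_process f W) (graph_map f T) r =
    (\<integral>\<^sup>+ \<omega>. first_exit_time (\<lambda>s. W T s \<omega>) {t. \<bar>t - T\<bar> < r \<and> \<bar>f t - f T\<bar> < r} \<partial>N)"
proof -
  have "first_exit_time (\<lambda>s. graph_process f W (graph_map f T) s \<omega>)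
      (Metric_space.mball (graph_of f) d_inf (graph_map f T) r) =
      first_exit_time (\<lambda>s. W T s \<omega>) {t. \<bar>t - T\<bar> < r \<and> \<bar>f t - f T\<bar> < r}" for \<omega>
    unfolding first_exit_time_def Metric_space.mball_def[OF Metric_space_d_inf]
    by (intro arg_cong[where f=Inf] image_cong)
      (auto simp: graph_process_def graph_map_def graph_of_def d_inf_def)
  then show ?thesis by (simp add: mean_exit_time_def)
qed

text \<open>The constant \<open>k\<close> is chosen so that
  \<open>K * (k * r powr (1 / \<beta>)) powr \<beta> = r\<close>. The condition
  \<open>\<beta> \<le> 1\<close> makes \<open>r powr (1 / \<beta>) \<le> r\<close> for small
  \<open>r\<close>, which settles the time coordinate.\<close>

lemma holder_ball_in_graph_ball:
  fixes f :: "real \<Rightarrow> real"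
  assumes hol: "locally_holder_at f \<beta> T" and \<beta>: "0 < \<beta>" "\<beta> \<le> 1"
  shows "\<exists>k>0. \<forall>\<^sub>F r in at_right 0. ball T (k * r powr (1 / \<beta>)) \<subseteq> {t. \<bar>t - T\<bar> < r \<and> \<bar>f t - f T\<bar> < r}"
proof -
  obtain C \<delta> where \<delta>: "0 < \<delta>"
    and C: "\<And>s s'. s \<in> ball T \<delta> \<Longrightarrow> s' \<in> ball T \<delta> \<Longrightarrow> \<bar>f s - f s'\<bar> \<le> C * \<bar>s - s'\<bar> powr \<beta>"
    using hol unfolding locally_holder_at_def by blast
  \<comment> \<open>The maximum with \<open>1\<close> makes \<open>K\<close> positive and
    \<open>k \<le> 1\<close>.\<close>
  define K where "K = max C 1"
  define k where "k = (1 / K) powr (1 / \<beta>)"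
  have K: "1 \<le> K" "C \<le> K" by (simp_all add: K_def)
  have k: "0 < k" using K by (simp add: k_def)
  have "k \<le> 1 powr (1 / \<beta>)" unfolding k_def using K \<beta> by (intro powr_mono2) auto
  then have k1: "k \<le> 1" by simp
  have "\<forall>\<^sub>F r in at_right 0. ball T (k * r powr (1 / \<beta>)) \<subseteq> {t. \<bar>t - T\<bar> < r \<and> \<bar>f t - f T\<bar> < r}"
  proof (rule eventually_at_rightI[of 0 "min 1 \<delta>"])
    fix r :: real assume r: "r \<in> {0<..<min 1 \<delta>}"
    have "r powr (1 / \<beta>) \<le> r powr 1" using r \<beta> by (intro powr_mono') auto
    then have kr: "k * r powr (1 / \<beta>) \<le> r"
      using k k1 r mult_mono[of k 1 "r powr (1 / \<beta>)" r] by auto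
    have pow: "(k * r powr (1 / \<beta>)) powr \<beta> = r / K"
      using K r \<beta> by (simp add: k_def powr_mult powr_powr)
    show "ball T (k * r powr (1 / \<beta>)) \<subseteq> {t. \<bar>t - T\<bar> < r \<and> \<bar>f t - f T\<bar> < r}"
    proof
      fix t assume "t \<in> ball T (k * r powr (1 / \<beta>))"
      then have t: "\<bar>t - T\<bar> < k * r powr (1 / \<beta>)" by (simp add: dist_real_def abs_minus_commute)
      have "\<bar>f t - f T\<bar> \<le> C * \<bar>t - T\<bar> powr \<beta>"
        using t kr r \<delta> by (intro C) (auto simp: dist_real_def abs_minus_commute)
      also have "\<dots> \<le> K * \<bar>t - T\<bar> powr \<beta>" using K by (intro mult_right_mono) auto
      also have "\<dots> < K * (r / K)"
        unfolding pow[symmetric] using K t \<beta> by (intro mult_strict_left_mono powr_less_mono2) auto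
      finally show "t \<in> {t. \<bar>t - T\<bar> < r \<and> \<bar>f t - f T\<bar> < r}" using t kr K by auto
    qed
  qed (use \<delta> in auto)
  with k show ?thesis by blast
qed

text \<open>Carries estimates at dyadic radii over to all small radii, at the cost of a factor
  \<open>2\<close>. The witness precedes the first exponent whose power falls below
  \<open>r\<close>.\<close>

lemma dyadic_scale:
  fixes r :: real
  assumes "0 < r" "r \<le> (1 / 2) ^ n0"
  obtains n where "n0 \<le> n" "r \<le> (1 / 2) ^ n" "(1 / 2) ^ n \<le> 2 * r"
proof -
  obtain m0 where m0: "(1 / 2) ^ m0 < r"
    using real_arch_pow_inv[of r "1 / 2"] assms by auto
  define m where "m = (LEAST m. (1 / 2) ^ m < r)"
  have m: "(1 / 2) ^ m < r" unfolding m_def using m0 by (rule LeastI)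
  have least: "r \<le> (1 / 2) ^ i" if "i < m" for i
    using not_less_Least that unfolding m_def by fastforce
  have "n0 < m"
  proof (rule ccontr)
    assume "\<not> n0 < m"
    then have "(1 / 2 :: real) ^ n0 \<le> (1 / 2) ^ m" by (intro power_decreasing) auto
    with m assms show False by simp
  qed
  then obtain n where n: "m = Suc n" "n0 \<le> n" by (cases m) auto
  with m least[of n] show ?thesis by (intro that[of n]) auto
qed

text \<open>For \<open>H > 0\<close>, positive exponents increasing to \<open>1 / H\<close>. They
  form a sequence so that almost sure statements about each can be combined.\<close>

definition sub_exponent :: "real \<Rightarrow> nat \<Rightarrow> real" where
  "sub_exponent H j = (1 - 1 / (real j + 2)) / H"

text \<open>Both signs of \<open>s\<close> are needed: an oscillation on one side only would not confine the
  process to a small interval.\<close>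

definition oscillates_at :: "real \<Rightarrow> (real \<Rightarrow> real) \<Rightarrow> real \<Rightarrow> bool" where
  "oscillates_at H f T \<longleftrightarrow> (\<forall>s\<in>{1, -1}. \<forall>j. \<forall>\<^sub>F n in sequentially.
     (1 / 2) ^ n \<le> \<bar>f (T + s * ((1 / 2) ^ n) powr sub_exponent H j) - f T\<bar>)"

lemma graph_local_walk_dimension:
  assumes H: "0 < H" "H < 1" and W: "wiener_process N T (W T)"
    and reg: "holder_regular_at f H T" and osc: "oscillates_at H f T"
  shows "has_local_walk_dimension (graph_of f) d_inf N (graph_process f W) (graph_map f T) (2 / H)"
  unfolding has_local_walk_dimension_def mean_exit_time_graph
proof (rule log_limit_from_power_bounds)
  fix \<epsilon> :: real assume \<epsilon>: "0 < \<epsilon>"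
  \<comment> \<open>Chosen so that \<open>2 / \<beta>0 = 2 / H + \<epsilon>\<close>; then
    \<open>\<beta>0 < H\<close>, and regularity yields a Hoelder exponent above
    \<open>\<beta>0\<close>.\<close>
  define \<beta>0 where "\<beta>0 = 2 / (2 / H + \<epsilon>)"
  have e: "0 < 2 / H + \<epsilon>" using H \<epsilon> by (simp add: add_pos_pos)
  then have \<beta>0: "0 < \<beta>0" "\<beta>0 < H"
    using H \<epsilon> by (simp_all add: \<beta>0_def pos_divide_less_eq distrib_left)
  have sup: "(SUP \<beta>\<in>{\<beta>. 0 < \<beta> \<and> locally_holder_at f \<beta> T}. ereal \<beta>) = ereal H"
    using reg by (simp add: holder_regular_at_def)
  then have "ereal \<beta>0 < (SUP \<beta>\<in>{\<beta>. 0 < \<beta> \<and> locally_holder_at f \<beta> T}. ereal \<beta>)"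
    using \<beta>0 by simp
  then obtain \<beta> where \<beta>: "0 < \<beta>" "locally_holder_at f \<beta> T" "\<beta>0 < \<beta>"
    unfolding less_SUP_iff by auto
  \<comment> \<open>The supremum also bounds \<open>\<beta>\<close> by \<open>H < 1\<close>, as the
    inclusion of balls demands \<open>\<beta> \<le> 1\<close>.\<close>
  have "ereal \<beta> \<le> ereal H" unfolding sup[symmetric] using \<beta> by (intro SUP_upper) auto
  then obtain k where k: "0 < k"
    and ev: "\<forall>\<^sub>F r in at_right 0. ball T (k * r powr (1 / \<beta>)) \<subseteq> {t. \<bar>t - T\<bar> < r \<and> \<bar>f t - f T\<bar> < r}"
    using holder_ball_in_graph_ball[OF \<beta>(2) \<beta>(1)] H by auto
  have exp_le: "2 * (1 / \<beta>) \<le> 2 / H + \<epsilon>"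
    using \<beta> e by (simp add: \<beta>0_def pos_divide_less_eq pos_divide_le_eq mult.commute)
  have small: "\<forall>\<^sub>F r in at_right 0. (0::real) < r \<and> r < 1"
    by (rule eventually_at_rightI[of 0 1]) auto
  show "\<exists>k>0. \<forall>\<^sub>F r in at_right 0. ennreal (k * r powr (2 / H + \<epsilon>)) \<le>
      (\<integral>\<^sup>+ \<omega>. first_exit_time (\<lambda>s. W T s \<omega>) {t. \<bar>t - T\<bar> < r \<and> \<bar>f t - f T\<bar> < r} \<partial>N)"
  proof (intro exI conjI)
    show "0 < k\<^sup>2 / 20000" using k by simp
    show "\<forall>\<^sub>F r in at_right 0. ennreal (k\<^sup>2 / 20000 * r powr (2 / H + \<epsilon>)) \<le>
      (\<integral>\<^sup>+ \<omega>. first_exit_time (\<lambda>s. W T s \<omega>) {t. \<bar>t - T\<bar> < r \<and> \<bar>f t - f T\<bar> < r} \<partial>N)"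
      using ev small
    proof eventually_elim
      case (elim r)
      have "r powr (2 / H + \<epsilon>) \<le> r powr (2 * (1 / \<beta>))"
        using elim exp_le by (intro powr_mono') auto
      also have "\<dots> = (r powr (1 / \<beta>))\<^sup>2"
        using elim by (simp add: power2_eq_square flip: powr_add)
      finally have "k\<^sup>2 / 20000 * r powr (2 / H + \<epsilon>) \<le> (k * r powr (1 / \<beta>))\<^sup>2 / 20000"
        using k by (simp add: power_mult_distrib)
      then have "ennreal (k\<^sup>2 / 20000 * r powr (2 / H + \<epsilon>)) \<le> ennreal ((k * r powr (1 / \<beta>))\<^sup>2 / 20000)"
        by (rule ennreal_leI)
      also note wiener_exit_lower[OF W _ elim(1)]
      finally show ?case using k elim by simp
    qed
  qed
next
  fix \<epsilon> :: real assume \<epsilon>: "0 < \<epsilon>"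
  \<comment> \<open>This makes the loss \<open>2 / H - 2 * \<gamma> = 2 / ((real j + 2) * H)\<close>
    at most \<open>\<epsilon>\<close>.\<close>
  obtain j :: nat where j: "2 / (H * \<epsilon>) < real j" using reals_Archimedean2 by blast
  define \<gamma> where "\<gamma> = sub_exponent H j"
  have "2 < real j * (H * \<epsilon>)" using j H \<epsilon> by (simp add: field_simps)
  then have "2 \<le> \<epsilon> * H * (real j + 2)" using H \<epsilon> by (simp add: algebra_simps add_increasing2)
  then have "2 / (real j + 2) / H \<le> \<epsilon>" using H by (simp add: divide_le_eq mult_ac)
  then have \<gamma>: "2 / H - \<epsilon> \<le> 2 * \<gamma>"
    by (simp add: \<gamma>_def sub_exponent_def diff_divide_distrib mult.commute)
  have \<gamma>0: "0 \<le> \<gamma>" using H by (simp add: \<gamma>_def sub_exponent_def)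
  have "\<forall>\<^sub>F n in sequentially. (\<forall>s\<in>{1, -1}. (1 / 2) ^ n \<le> \<bar>f (T + s * ((1 / 2) ^ n) powr \<gamma>) - f T\<bar>)"
    using osc unfolding oscillates_at_def \<gamma>_def by (simp add: eventually_conj)
  then obtain n0 where n0: "\<And>n s. n0 \<le> n \<Longrightarrow> s \<in> {1, -1} \<Longrightarrow>
      (1 / 2) ^ n \<le> \<bar>f (T + s * ((1 / 2) ^ n) powr \<gamma>) - f T\<bar>"
    unfolding eventually_sequentially by blast
  show "\<exists>k>0. \<forall>\<^sub>F r in at_right 0.
      (\<integral>\<^sup>+ \<omega>. first_exit_time (\<lambda>s. W T s \<omega>) {t. \<bar>t - T\<bar> < r \<and> \<bar>f t - f T\<bar> < r} \<partial>N)
      \<le> ennreal (k * r powr (2 / H - \<epsilon>))"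
  proof (intro exI conjI)
    show "0 < 32 * (2::real) powr (2 * \<gamma>)" by simp
    show "\<forall>\<^sub>F r in at_right 0.
      (\<integral>\<^sup>+ \<omega>. first_exit_time (\<lambda>s. W T s \<omega>) {t. \<bar>t - T\<bar> < r \<and> \<bar>f t - f T\<bar> < r} \<partial>N)
      \<le> ennreal (32 * 2 powr (2 * \<gamma>) * r powr (2 / H - \<epsilon>))"
    proof (rule eventually_at_rightI[of 0 "(1 / 2) ^ n0"])
      fix r :: real assume r: "r \<in> {0<..<(1 / 2) ^ n0}"
      have r1: "r \<le> 1" using r power_le_one[of "1 / 2 :: real" n0] by auto
      obtain n where n: "n0 \<le> n" "r \<le> (1 / 2) ^ n" "(1 / 2) ^ n \<le> 2 * r"
        using dyadic_scale[of r n0] r by auto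
      \<comment> \<open>At \<open>T + u\<close> and \<open>T - u\<close> the function differs from
        \<open>f T\<close> by at least \<open>(1 / 2) ^ n \<ge> r\<close>, so both points lie
        outside the ball, while \<open>u \<le> (2 * r) powr \<gamma>\<close>.\<close>
      define u :: real where "u = ((1 / 2) ^ n) powr \<gamma>"
      have u: "0 < u" by (simp add: u_def)
      have "(\<integral>\<^sup>+ \<omega>. first_exit_time (\<lambda>s. W T s \<omega>) {t. \<bar>t - T\<bar> < r \<and> \<bar>f t - f T\<bar> < r} \<partial>N)
          \<le> ennreal (32 * u\<^sup>2)"
        using n0[OF n(1), of 1] n0[OF n(1), of "-1"] n(2)
        by (intro wiener_exit_upper[OF W u]) (auto simp: u_def)
      also have "32 * u\<^sup>2 \<le> 32 * 2 powr (2 * \<gamma>) * r powr (2 / H - \<epsilon>)"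
      proof -
        have "u\<^sup>2 = ((1 / 2) ^ n) powr (2 * \<gamma>)"
          by (simp add: u_def power2_eq_square flip: powr_add)
        also have "\<dots> \<le> (2 * r) powr (2 * \<gamma>)" using n \<gamma>0 by (intro powr_mono2) auto
        also have "\<dots> = 2 powr (2 * \<gamma>) * r powr (2 * \<gamma>)" using r by (simp add: powr_mult)
        also have "\<dots> \<le> 2 powr (2 * \<gamma>) * r powr (2 / H - \<epsilon>)"
          using r r1 \<gamma> by (intro mult_left_mono powr_mono') auto
        finally show ?thesis by simp
      qed
      finally show "(\<integral>\<^sup>+ \<omega>. first_exit_time (\<lambda>s. W T s \<omega>) {t. \<bar>t - T\<bar> < r \<and> \<bar>f t - f T\<bar> < r} \<partial>N)
        \<le> ennreal (32 * 2 powr (2 * \<gamma>) * r powr (2 / H - \<epsilon>))"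
        by (simp add: ennreal_leI)
    qed simp
  qed
qed

section \<open>Null sets of the graph measure\<close>

text \<open>As \<open>Q\<close> is an arbitrary predicate, a measurable null cover \<open>Z\<close>
  of its exceptional times is carried over. Its preimage under \<open>fst\<close> is measurable at
  once and pulls back along the graph map to \<open>Z\<close>.\<close>

lemma AE_graph_measure:
  assumes f: "f \<in> borel_measurable borel" and ae: "AE t in lborel. Q (graph_map f t)"
  shows "AE x in graph_measure f. Q x"
proof -
  let ?R = "restrict_space borel (graph_of f)"
  have g: "graph_map f \<in> measurable lborel ?R"
    using f unfolding graph_map_def graph_of_def
    by (intro measurable_restrict_space2) (auto simp: graph_map_def[abs_def])
  obtain Z where Z: "{t \<in> space lborel. \<not> Q (graph_map f t)} \<subseteq> Z" "emeasure lborel Z = 0" "Z \<in> sets lborel"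
    using AE_E[OF ae] by blast
  have "fst -` Z \<inter> space ?R \<in> sets ?R"
    using Z(3) measurable_restrict_space1[of "fst :: real \<times> real \<Rightarrow> real" borel borel "graph_of f"]
    by (intro measurable_sets[of fst ?R borel]) (auto simp: borel_measurable_continuous_onI continuous_on_fst)
  moreover have "graph_map f -` (fst -` Z \<inter> space ?R) \<inter> space lborel = Z"
    by (auto simp: graph_map_def graph_of_def space_restrict_space)
  ultimately have "emeasure (graph_measure f) (fst -` Z \<inter> space ?R) = 0"
    "fst -` Z \<inter> space ?R \<in> sets (graph_measure f)"
    using Z g by (simp_all add: graph_measure_def emeasure_distr)
  moreover have "{x \<in> space (graph_measure f). \<not> Q x} \<subseteq> fst -` Z \<inter> space ?R"
    using Z(1) by (auto simp: graph_measure_def space_restrict_space graph_of_def graph_map_def)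
  ultimately show ?thesis by (intro AE_I)
qed

section \<open>Increments of fractional Brownian motion\<close>

text \<open>Integrability is not part of the moment equations, as a Bochner integral defaults to
  \<open>0\<close>; it is what permits combining means and covariances linearly.\<close>

lemma gaussian_rv_integrable:
  assumes "prob_space M" and g: "gaussian_rv M X"
  shows "integrable M X" "integrable M (\<lambda>\<omega>. (X \<omega>)\<^sup>2)"
proof -
  interpret prob_space M by fact
  have [measurable]: "X \<in> borel_measurable M" using g by (simp add: gaussian_rv_def)
  consider m where "AE \<omega> in M. X \<omega> = m"
    | m \<sigma> where "0 < \<sigma>" "distributed M lborel X (normal_density m \<sigma>)"
    using g by (auto simp: gaussian_rv_def)
  then have "integrable M X \<and> integrable M (\<lambda>\<omega>. (X \<omega>)\<^sup>2)"
  proof cases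
    case 1
    have "AE \<omega> in M. (X \<omega>)\<^sup>2 = m\<^sup>2" using 1 by eventually_elim simp
    with 1 show ?thesis
      using integrable_cong_AE[of X M "\<lambda>_. m"] integrable_cong_AE[of "\<lambda>\<omega>. (X \<omega>)\<^sup>2" M "\<lambda>_. m\<^sup>2"] by simp
  next
    case 2
    have X: "integrable M X"
      using integrable_normal_moment_nz_1[OF 2(1), of m] distributed_integrable[OF 2(2), of "\<lambda>y. y"] by simp
    have X2: "integrable M (\<lambda>\<omega>. (X \<omega> - m)\<^sup>2)"
      using integrable_normal_moment[OF 2(1), of m 2] distributed_integrable[OF 2(2), of "\<lambda>y. (y - m)\<^sup>2"] by simp
    have "integrable M (\<lambda>\<omega>. (X \<omega> - m)\<^sup>2 + 2 * m * X \<omega> - m\<^sup>2)"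
      using X X2 by (intro Bochner_Integration.integrable_diff Bochner_Integration.integrable_add) auto
    also have "(\<lambda>\<omega>. (X \<omega> - m)\<^sup>2 + 2 * m * X \<omega> - m\<^sup>2) = (\<lambda>\<omega>. (X \<omega>)\<^sup>2)"
      by (auto simp: power2_eq_square algebra_simps)
    finally show ?thesis using X by simp
  qed
  then show "integrable M X" "integrable M (\<lambda>\<omega>. (X \<omega>)\<^sup>2)" by auto
qed

text \<open>Positive variance excludes the degenerate alternative, and in the other one mean and
  variance determine the parameters.\<close>

lemma gaussian_rv_centered_normal:
  assumes "prob_space M" and g: "gaussian_rv M X"
    and mean: "(LINT \<omega>|M. X \<omega>) = 0" and var: "(LINT \<omega>|M. (X \<omega>)\<^sup>2) = v\<^sup>2" and v: "0 < v"
  shows "distributed M lborel X (normal_density 0 v)"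
proof -
  interpret prob_space M by fact
  have [measurable]: "X \<in> borel_measurable M" using g by (simp add: gaussian_rv_def)
  consider m where "AE \<omega> in M. X \<omega> = m"
    | m \<sigma> where "0 < \<sigma>" "distributed M lborel X (normal_density m \<sigma>)"
    using g by (auto simp: gaussian_rv_def)
  then show ?thesis
  proof cases
    case 1
    have "expectation X = (LINT \<omega>|M. m)" using 1 by (intro integral_cong_AE) auto
    then have "m = 0" using mean by (simp add: prob_space)
    with 1 have "AE \<omega> in M. (X \<omega>)\<^sup>2 = 0" by simp
    then have "(LINT \<omega>|M. (X \<omega>)\<^sup>2) = (LINT \<omega>|M. 0)" by (intro integral_cong_AE) auto
    with var v show ?thesis by simp
  next
    case 2
    have "m = 0" using normal_distributed_expectation[OF 2] mean by simp
    moreover have "\<sigma>\<^sup>2 = v\<^sup>2" using normal_distributed_variance[OF 2] mean var by simp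
    then have "\<sigma> = v" using 2 v by simp
    ultimately show ?thesis using 2 by simp
  qed
qed

lemma fbm_increment_normal:
  assumes fbm: "fractional_brownian_motion M H B" and v: "v \<noteq> 0"
  shows "distributed M lborel (\<lambda>\<omega>. B (t + v) \<omega> - B t \<omega>) (normal_density 0 (\<bar>v\<bar> powr H))"
proof -
  have gp: "prob_space M" and lin: "\<And>J c. finite J \<Longrightarrow> gaussian_rv M (\<lambda>\<omega>. \<Sum>i\<in>J. c i * B i \<omega>)"
    and mean: "\<And>t. (LINT \<omega>|M. B t \<omega>) = 0"
    and cov: "\<And>s t. (LINT \<omega>|M. B s \<omega> * B t \<omega>) =
        (\<bar>t\<bar> powr (2 * H) + \<bar>s\<bar> powr (2 * H) - \<bar>t - s\<bar> powr (2 * H)) / 2"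
    using fbm by (auto simp: fractional_brownian_motion_def gaussian_process_def)
  have gB: "gaussian_rv M (B s)" for s
    using lin[of "{s}" "\<lambda>_. 1"] by simp
  have meas[measurable]: "B s \<in> borel_measurable M" for s
    using gB by (simp add: gaussian_rv_def)
  note int = gaussian_rv_integrable[OF gp gB]
  have intp: "integrable M (\<lambda>\<omega>. B s \<omega> * B s' \<omega>)" for s s'
  proof (rule Bochner_Integration.integrable_bound)
    show "integrable M (\<lambda>\<omega>. (B s \<omega>)\<^sup>2 + (B s' \<omega>)\<^sup>2)"
      using int(2) by (intro Bochner_Integration.integrable_add)
    show "AE \<omega> in M. norm (B s \<omega> * B s' \<omega>) \<le> norm ((B s \<omega>)\<^sup>2 + (B s' \<omega>)\<^sup>2)"
    proof (rule AE_I2)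
      fix \<omega>
      have "\<bar>a * b\<bar> \<le> a\<^sup>2 + b\<^sup>2" for a b :: real
        using sum_squares_bound[of "\<bar>a\<bar>" "\<bar>b\<bar>"] mult_nonneg_nonneg[of "\<bar>a\<bar>" "\<bar>b\<bar>"]
        unfolding abs_mult power2_abs by linarith
      then show "norm (B s \<omega> * B s' \<omega>) \<le> norm ((B s \<omega>)\<^sup>2 + (B s' \<omega>)\<^sup>2)" by simp
    qed
  qed measurable
  show ?thesis
  proof (rule gaussian_rv_centered_normal[OF gp])
    \<comment> \<open>As \<open>v \<noteq> 0\<close>, the indices \<open>t\<close> and
      \<open>t + v\<close> are distinct and the coefficients do give the increment.\<close>
    show "gaussian_rv M (\<lambda>\<omega>. B (t + v) \<omega> - B t \<omega>)"
      using lin[of "{t, t + v}" "\<lambda>i. if i = t then -1 else 1"] v by simp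
    show "(LINT \<omega>|M. B (t + v) \<omega> - B t \<omega>) = 0"
      using int by (simp add: mean)
    have "(LINT \<omega>|M. (B (t + v) \<omega> - B t \<omega>)\<^sup>2) =
        (LINT \<omega>|M. B (t + v) \<omega> * B (t + v) \<omega> + B t \<omega> * B t \<omega> - 2 * (B (t + v) \<omega> * B t \<omega>))"
      by (intro Bochner_Integration.integral_cong) (auto simp: power2_eq_square algebra_simps)
    also have "\<dots> = (LINT \<omega>|M. B (t + v) \<omega> * B (t + v) \<omega>) + (LINT \<omega>|M. B t \<omega> * B t \<omega>)
        - 2 * (LINT \<omega>|M. B (t + v) \<omega> * B t \<omega>)"
      using intp by simp
    also have "\<dots> = \<bar>v\<bar> powr (2 * H)"
      by (simp add: cov field_simps)
    also have "\<dots> = (\<bar>v\<bar> powr H)\<^sup>2"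
      using v by (simp add: power2_eq_square flip: powr_add)
    finally show "(LINT \<omega>|M. (B (t + v) \<omega> - B t \<omega>)\<^sup>2) = (\<bar>v\<bar> powr H)\<^sup>2" .
    show "0 < \<bar>v\<bar> powr H" using v by simp
  qed
qed

section \<open>Oscillation at almost every time\<close>

text \<open>Rounding time down to multiples of \<open>1 / real (Suc n)\<close> gives jointly
  measurable processes, as only countably many times occur; they converge pointwise by continuity of
  the paths.\<close>

lemma continuous_process_measurable:
  fixes B :: "real \<Rightarrow> 'w \<Rightarrow> real"
  assumes meas: "\<And>t. B t \<in> borel_measurable M"
    and cont: "\<And>\<omega>. \<omega> \<in> space M \<Longrightarrow> continuous_on UNIV (\<lambda>t. B t \<omega>)"
  shows "(\<lambda>(\<omega>, t). B t \<omega>) \<in> borel_measurable (M \<Otimes>\<^sub>M lborel)"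
proof (rule borel_measurable_LIMSEQ_real)
  define q where "q n t = of_int \<lfloor>t * real (Suc n)\<rfloor> / real (Suc n)" for n and t :: real
  show "(\<lambda>(\<omega>, t). B (q n t) \<omega>) \<in> borel_measurable (M \<Otimes>\<^sub>M lborel)" for n
  proof -
    have "(\<lambda>x. B (of_int i / real (Suc n)) (fst x)) \<in> borel_measurable (M \<Otimes>\<^sub>M lborel)" for i :: int
      using meas by (intro measurable_compose[OF measurable_fst])
    moreover have "(\<lambda>x. \<lfloor>snd x * real (Suc n)\<rfloor>) \<in> measurable (M \<Otimes>\<^sub>M lborel) (count_space UNIV)"
      by measurable
    ultimately have "(\<lambda>x. B (of_int \<lfloor>snd x * real (Suc n)\<rfloor> / real (Suc n)) (fst x)) \<in> borel_measurable (M \<Otimes>\<^sub>M lborel)"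
      by (rule measurable_compose_countable)
    then show ?thesis by (simp add: q_def split_beta')
  qed
  have q_lim: "(\<lambda>n. q n t) \<longlonglongrightarrow> t" for t
  proof (rule tendsto_sandwich[of "\<lambda>n. t - 1 / real (Suc n)" _ _ "\<lambda>_. t"])
    have "t - 1 / real (Suc n) \<le> q n t" "q n t \<le> t" for n
    proof -
      have "t * real (Suc n) - 1 \<le> of_int \<lfloor>t * real (Suc n)\<rfloor>" by linarith
      from divide_right_mono[OF this, of "real (Suc n)"]
      show "t - 1 / real (Suc n) \<le> q n t" by (simp add: q_def diff_divide_distrib)
      from divide_right_mono[OF of_int_floor_le[of "t * real (Suc n)"], of "real (Suc n)"]
      show "q n t \<le> t" by (simp add: q_def)
    qed
    then show "\<forall>\<^sub>F n in sequentially. t - 1 / real (Suc n) \<le> q n t" "\<forall>\<^sub>F n in sequentially. q n t \<le> t"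
      by auto
    have "(\<lambda>n. t - 1 / real (Suc n)) \<longlonglongrightarrow> t - 0"
      by (intro tendsto_intros LIMSEQ_Suc lim_1_over_n)
    then show "(\<lambda>n. t - 1 / real (Suc n)) \<longlonglongrightarrow> t" by simp
  qed simp
  show "(\<lambda>n. case x of (\<omega>, t) \<Rightarrow> B (q n t) \<omega>) \<longlonglongrightarrow> (case x of (\<omega>, t) \<Rightarrow> B t \<omega>)"
    if "x \<in> space (M \<Otimes>\<^sub>M lborel)" for x
    using that q_lim
    by (auto simp: space_pair_measure intro: continuous_on_tendsto_compose[OF cont])
qed

lemma fbm_increments_large:
  assumes H: "0 < H" and fbm: "fractional_brownian_motion M H B" and s: "s \<in> {1, -1}"
  shows "AE \<omega> in M. \<forall>\<^sub>F n in sequentially.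
    (1 / 2) ^ n \<le> \<bar>B (T + s * ((1 / 2) ^ n) powr sub_exponent H j) \<omega> - B T \<omega>\<bar>"
proof -
  interpret prob_space M using fbm by (simp add: fractional_brownian_motion_def gaussian_process_def)
  define u where "u n = ((1 / 2 :: real) ^ n) powr sub_exponent H j" for n
  define A where "A n = {\<omega> \<in> space M. \<bar>B (T + s * u n) \<omega> - B T \<omega>\<bar> < (1 / 2) ^ n}" for n
  define p where "p = 1 / (real j + 2)"
  have u: "0 < u n" for n by (simp add: u_def)
  have su: "s * u n \<noteq> 0" "\<bar>s * u n\<bar> = u n" for n using s u[of n] by auto
  note normal = fbm_increment_normal[OF fbm su(1), of T, unfolded su(2)]
  have "(\<lambda>\<omega>. B (T + s * u n) \<omega> - B T \<omega>) \<in> borel_measurable M" for n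
    using distributed_measurable[OF normal[of n]] by simp
  then have meas[measurable]: "A n \<in> sets M" for n
    unfolding A_def by measurable
  have prob_A: "prob (A n) \<le> ((1 / 2) powr p) ^ n" for n
  proof -
    have "prob (A n) \<le> (1 / 2) ^ n / u n powr H"
      unfolding A_def using u[of n] by (intro normal_prob_small[OF _ normal]) auto
    \<comment> \<open>Here \<open>sub_exponent H j * H = 1 - p\<close>, which leaves the summable
      bound \<open>((1 / 2) powr p) ^ n\<close>.\<close>
    also have "u n powr H = ((1 / 2) ^ n) powr (1 - p)"
      using H by (simp add: u_def powr_powr sub_exponent_def p_def)
    also have "(1 / 2 :: real) ^ n / ((1 / 2) ^ n) powr (1 - p) = ((1 / 2) ^ n) powr p"
      by (simp add: powr_diff)
    also have "\<dots> = ((1 / 2) powr p) ^ n"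
      by (simp add: powr_powr mult.commute flip: powr_realpow)
    finally show ?thesis .
  qed
  have "(1 / 2 :: real) powr p < 1" using powr_less_mono2[of p "1 / 2" 1] by (simp add: p_def)
  then have "summable (\<lambda>n. ((1 / 2 :: real) powr p) ^ n)"
    by (intro summable_geometric) simp
  then have "summable (\<lambda>n. prob (A n))"
    by (rule summable_comparison_test') (use prob_A in auto)
  then have "AE \<omega> in M. \<forall>\<^sub>F n in sequentially. \<omega> \<in> space M - A n"
    by (intro borel_cantelli_AE1) (auto simp: emeasure_eq_measure)
  then show ?thesis
    by eventually_elim (auto simp: A_def u_def not_less elim: eventually_mono)
qed

text \<open>Exchanging the two almost-everywhere quantifiers requires the good pairs to form a
  measurable set; joint measurability and the countable quantifiers in \<open>oscillates_at\<close>
  ensure this.\<close>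

lemma fbm_oscillates:
  assumes H: "0 < H" and fbm: "fractional_brownian_motion M H B"
    and cont: "\<And>\<omega>. \<omega> \<in> space M \<Longrightarrow> continuous_on UNIV (\<lambda>t. B t \<omega>)"
  shows "AE \<omega> in M. AE T in lborel. oscillates_at H (\<lambda>t. B t \<omega>) T"
proof -
  interpret prob_space M using fbm by (simp add: fractional_brownian_motion_def gaussian_process_def)
  interpret pair_sigma_finite M lborel ..
  have lin: "finite J \<Longrightarrow> gaussian_rv M (\<lambda>\<omega>. \<Sum>i\<in>J. c i * B i \<omega>)" for J c
    using fbm by (simp add: fractional_brownian_motion_def gaussian_process_def)
  have "B t \<in> borel_measurable M" for t
    using lin[of "{t}" "\<lambda>_. 1"] by (simp add: gaussian_rv_def)
  note joint = continuous_process_measurable[OF this cont]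
  have B_meas: "(\<lambda>x. B (snd x + v) (fst x)) \<in> borel_measurable (M \<Otimes>\<^sub>M lborel)" for v
    using measurable_compose[OF _ joint, of "\<lambda>x. (fst x, snd x + v)" "M \<Otimes>\<^sub>M lborel"]
    by simp
  have [measurable]: "Measurable.pred (M \<Otimes>\<^sub>M lborel)
      (\<lambda>x. (1 / 2) ^ n \<le> \<bar>B (snd x + v) (fst x) - B (snd x) (fst x)\<bar>)" for n v
    using B_meas[of v] B_meas[of 0] by simp
  have "AE T in lborel. AE \<omega> in M. oscillates_at H (\<lambda>t. B t \<omega>) T"
    unfolding oscillates_at_def
    by (intro AE_I2 AE_finite_allI AE_all_countable[THEN iffD2] allI fbm_increments_large[OF H fbm]) auto
  moreover have "{x \<in> space (M \<Otimes>\<^sub>M lborel). oscillates_at H (\<lambda>t. B t (fst x)) (snd x)} \<in> sets (M \<Otimes>\<^sub>M lborel)"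
    unfolding oscillates_at_def by measurable
  ultimately show ?thesis by (subst AE_commute)
qed

theorem theorem3p13:
  fixes H :: real
    and M :: "'w measure" and B :: "real \<Rightarrow> 'w \<Rightarrow> real"
    and N :: "'v measure" and W :: "real \<Rightarrow> real \<Rightarrow> 'v \<Rightarrow> real"
  assumes "0 < H" and "H < 1"
    and "fractional_brownian_motion M H B"
    and "\<forall>\<omega>\<in>space M. continuous_on UNIV (\<lambda>t. B t \<omega>)"
    and "AE \<omega> in M. \<forall>t. holder_regular_at (\<lambda>t. B t \<omega>) H t"
    and "\<forall>T. wiener_process N T (W T)"
  shows "AE \<omega> in M.
    has_walk_dimension (graph_of (\<lambda>t. B t \<omega>)) d_inf (graph_measure (\<lambda>t. B t \<omega>))
      N (graph_process (\<lambda>t. B t \<omega>) W) (2 / H)"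
proof -
  have "AE \<omega> in M. AE T in lborel. oscillates_at H (\<lambda>t. B t \<omega>) T"
    using assms(4) by (intro fbm_oscillates[OF assms(1,3)]) auto
  then show ?thesis
    using assms(5) AE_space
  proof eventually_elim
    case (elim \<omega>)
    \<comment> \<open>On a good path regularity holds at every \<open>T\<close> and oscillation at
      almost every \<open>T\<close>.\<close>
    have "AE T in lborel. has_local_walk_dimension (graph_of (\<lambda>t. B t \<omega>)) d_inf N
        (graph_process (\<lambda>t. B t \<omega>) W) (graph_map (\<lambda>t. B t \<omega>) T) (2 / H)"
      using elim(1)
      by eventually_elim (use assms elim(2) in \<open>auto intro!: graph_local_walk_dimension\<close>)
    moreover have "(\<lambda>t. B t \<omega>) \<in> borel_measurable borel"
      using assms(4) elim(3) by (intro borel_measurable_continuous_onI) auto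
    ultimately show ?case
      unfolding has_walk_dimension_def by (rule AE_graph_measure[rotated])
  qed
qed

end
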